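(* Let $Q$ be a quandle and let $\rho : Q \to GL(V)$ be a finite dimensional unitary quandle representation. Then $\rho$ is completely reducible, i.e. $V$ decomposes as a direct sum of irreducible subrepresentations.
   Context: A quandle is a set $Q$ with a binary operation $\triangleright$ such that: $x\triangleright x=x$ for all $x\in Q$; for all $x,y\in Q$ there is a unique $z\in Q$ with $x\triangleright z=y$; and $x\triangleright(y\triangleright z)=(x\triangleright y)\triangleright(x\triangleright z)$ for all $x,y,z\in Q$. A quandle representation of $Q$ on a vector space $V$ is a map $\rho:Q\to GL(V)$ with $\rho(x\triangleright y)=\rho(x)\rho(y)\rho(x)^{-1}$ for all $x,y\in Q$. A subrepresentation is a vector subspace $W\subset V$ stable under all elements of $\rho(Q)$. A representation (or subrepresentation) is irreducible if it has no subrepresentations other than $0$ and itself. A quandle representation is unitary if $V$ (a real or complex vector space) is endowed with an inner product for which the elements of $\rho(Q)$ are isometries. A quandle representation is completely reducible if it can be decomposed as a direct sum of irreducible subrepresentations. *)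

theory Defs
  imports Complex_Main
begin

locale quandle =
  fixes Q :: "'q set"
    and tri :: "'q \<Rightarrow> 'q \<Rightarrow> 'q"  (infixl "\<triangleright>" 70)
  assumes closed: "x \<in> Q \<Longrightarrow> y \<in> Q \<Longrightarrow> x \<triangleright> y \<in> Q"
    and idem: "x \<in> Q \<Longrightarrow> x \<triangleright> x = x"
    and ex1_left_div: "x \<in> Q \<Longrightarrow> y \<in> Q \<Longrightarrow> \<exists>!z. z \<in> Q \<and> x \<triangleright> z = y"
    and self_distrib:
      "x \<in> Q \<Longrightarrow> y \<in> Q \<Longrightarrow> z \<in> Q \<Longrightarrow> x \<triangleright> (y \<triangleright> z) = (x \<triangleright> y) \<triangleright> (x \<triangleright> z)"

context vector_space
begin

definition GL :: "('b \<Rightarrow> 'b) set" where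
  "GL = {f. Vector_Spaces.linear scale scale f \<and> bij f}"

text \<open>The whole space is the internal direct sum of the (possibly infinite) collection of
  subspaces \<open>\<W>\<close>: every vector is, in exactly one way, a sum of finitely many nonzero components,
  one from each member. The component function is set to 0 outside \<open>\<W>\<close> so that uniqueness makes
  sense for a total function. Indexing by the subspaces themselves loses no generality, because
  a nonzero subspace cannot occur twice in a direct sum.\<close>

definition internal_direct_sum :: "'b set set \<Rightarrow> bool" where
  "internal_direct_sum \<W> \<longleftrightarrow>
     (\<forall>W\<in>\<W>. subspace W) \<and>
     (\<forall>v. \<exists>!c. (\<forall>W\<in>\<W>. c W \<in> W) \<and> (\<forall>W. W \<notin> \<W> \<longrightarrow> c W = 0) \<and>
              finite {W. c W \<noteq> 0} \<and> v = (\<Sum>W | c W \<noteq> 0. c W))"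

end

locale quandle_rep = quandle Q tri + vector_space scale
  for Q :: "'q set"
    and tri :: "'q \<Rightarrow> 'q \<Rightarrow> 'q"  (infixl "\<triangleright>" 70)
    and scale :: "'k::field \<Rightarrow> 'v::ab_group_add \<Rightarrow> 'v" +
  fixes \<rho> :: "'q \<Rightarrow> 'v \<Rightarrow> 'v"
  assumes rep_GL: "x \<in> Q \<Longrightarrow> \<rho> x \<in> GL"
    and rep_tri: "x \<in> Q \<Longrightarrow> y \<in> Q \<Longrightarrow> \<rho> (x \<triangleright> y) = \<rho> x \<circ> \<rho> y \<circ> inv (\<rho> x)"
begin

definition subrep :: "'v set \<Rightarrow> bool" where
  "subrep W \<longleftrightarrow> subspace W \<and> (\<forall>x\<in>Q. \<rho> x ` W \<subseteq> W)"

text \<open>The zero subrepresentation is not excluded.\<close>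

definition irreducible_subrep :: "'v set \<Rightarrow> bool" where
  "irreducible_subrep W \<longleftrightarrow>
     subrep W \<and> (\<forall>U. subrep U \<and> U \<subseteq> W \<longrightarrow> U = {0} \<or> U = W)"

definition completely_reducible :: bool where
  "completely_reducible \<longleftrightarrow>
     (\<exists>\<W>. (\<forall>W\<in>\<W>. irreducible_subrep W) \<and> internal_direct_sum \<W>)"

end

locale real_inner_product = vector_space scale
  for scale :: "real \<Rightarrow> 'v::ab_group_add \<Rightarrow> 'v" +
  fixes ip :: "'v \<Rightarrow> 'v \<Rightarrow> real"
  assumes ip_add_left: "ip (u + v) w = ip u w + ip v w"
    and ip_scale_left: "ip (scale a v) w = a * ip v w"
    and ip_sym: "ip v w = ip w v"
    and ip_pos: "v \<noteq> 0 \<Longrightarrow> 0 < ip v v"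

text \<open>Sesquilinear forms are linear in the first argument; \<open>ip v v\<close> is real by \<open>ip_sym\<close>.\<close>

locale complex_inner_product = vector_space scale
  for scale :: "complex \<Rightarrow> 'v::ab_group_add \<Rightarrow> 'v" +
  fixes ip :: "'v \<Rightarrow> 'v \<Rightarrow> complex"
  assumes ip_add_left: "ip (u + v) w = ip u w + ip v w"
    and ip_scale_left: "ip (scale a v) w = a * ip v w"
    and ip_sym: "ip v w = cnj (ip w v)"
    and ip_pos: "v \<noteq> 0 \<Longrightarrow> 0 < Re (ip v v)"

locale real_unitary_quandle_rep =
  quandle_rep Q tri scale \<rho> + real_inner_product scale ip
  for Q :: "'q set" and tri :: "'q \<Rightarrow> 'q \<Rightarrow> 'q"
    and scale :: "real \<Rightarrow> 'v::ab_group_add \<Rightarrow> 'v"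
    and \<rho> :: "'q \<Rightarrow> 'v \<Rightarrow> 'v" and ip :: "'v \<Rightarrow> 'v \<Rightarrow> real" +
  assumes isometry: "x \<in> Q \<Longrightarrow> ip (\<rho> x v) (\<rho> x w) = ip v w"

locale complex_unitary_quandle_rep =
  quandle_rep Q tri scale \<rho> + complex_inner_product scale ip
  for Q :: "'q set" and tri :: "'q \<Rightarrow> 'q \<Rightarrow> 'q"
    and scale :: "complex \<Rightarrow> 'v::ab_group_add \<Rightarrow> 'v"
    and \<rho> :: "'q \<Rightarrow> 'v \<Rightarrow> 'v" and ip :: "'v \<Rightarrow> 'v \<Rightarrow> complex" +
  assumes isometry: "x \<in> Q \<Longrightarrow> ip (\<rho> x v) (\<rho> x w) = ip v w"

end

theory Submission
  imports Defs
begin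

text \<open>The orthogonal complement of a subrepresentation is again a subrepresentation, because
  each \<open>\<rho> x\<close> is an isometry which, by finiteness of the dimension, maps a stable subspace onto
  itself. Splitting off complements, by induction on the dimension, gives pairwise orthogonal
  irreducible subrepresentations that span the space, and orthogonality makes the sum direct.
  Positivity is used only through anisotropy, which lets one argument serve both for real and for
  complex scalars.\<close>

section \<open>Orthogonality and projections for an anisotropic form\<close>

text \<open>Linearity in the first argument and symmetry of orthogonality are common to symmetric
  real and Hermitian complex forms. The second argument is handled by swapping, through
  \<open>orth_sym\<close>.\<close>

locale anisotropic_form = finite_dimensional_vector_space scale Basis
  for scale :: "'k::field \<Rightarrow> 'v::ab_group_add \<Rightarrow> 'v" and Basis :: "'v set" +
  fixes ip :: "'v \<Rightarrow> 'v \<Rightarrow> 'k"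
  assumes ip_add_left: "ip (u + v) w = ip u w + ip v w"
    and ip_scale_left: "ip (scale a v) w = a * ip v w"
    and orth_sym: "ip v w = 0 \<Longrightarrow> ip w v = 0"
    and ip_anisotropic: "ip v v = 0 \<Longrightarrow> v = 0"
begin

definition orth_compl :: "'v set \<Rightarrow> 'v set" where
  "orth_compl S = {v. \<forall>w\<in>S. ip v w = 0}"

lemma ip_zero_left: "ip 0 w = 0"
  using ip_scale_left[of 0 0 w] by simp

lemma ip_diff_left: "ip (u - v) w = ip u w - ip v w"
  using ip_add_left[of "u - v" v w] by (simp add: algebra_simps)

lemma ip_sum_left: "ip (sum f A) w = (\<Sum>a\<in>A. ip (f a) w)"
  by (induction A rule: infinite_finite_induct) (simp_all add: ip_zero_left ip_add_left)

lemma subspace_orth_compl: "subspace (orth_compl S)"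
  by (rule subspaceI) (auto simp: orth_compl_def ip_zero_left ip_add_left ip_scale_left)

text \<open>Symmetry of orthogonality makes \<open>orth_compl\<close> a Galois connection with
  itself.\<close>

lemma subset_orth_compl_iff: "S \<subseteq> orth_compl T \<longleftrightarrow> T \<subseteq> orth_compl S"
  unfolding orth_compl_def using orth_sym by blast

text \<open>Linearity in the second argument is not at hand, so the argument goes through the double
  complement: it is a subspace containing \<open>S\<close>, hence contains \<open>span S\<close>,
  and the Galois connection turns this inclusion around.\<close>

lemma orth_compl_span: "orth_compl (span S) = orth_compl S"
proof
  have "S \<subseteq> orth_compl (orth_compl S)"
    using subset_orth_compl_iff by blast
  then have "span S \<subseteq> orth_compl (orth_compl S)"
    by (rule span_minimal) (rule subspace_orth_compl)
  then show "orth_compl S \<subseteq> orth_compl (span S)"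
    using subset_orth_compl_iff by blast
  show "orth_compl (span S) \<subseteq> orth_compl S"
    using span_superset by (auto simp: orth_compl_def)
qed

text \<open>The inductive step is Gram--Schmidt.\<close>

lemma orthogonal_projection_span:
  assumes "finite S"
  shows "\<exists>p\<in>span S. v - p \<in> orth_compl S"
  using assms
proof (induction S arbitrary: v)
  case empty
  show ?case by (simp add: orth_compl_def)
next
  case (insert a S)
  obtain p where p: "p \<in> span S" "v - p \<in> orth_compl S" using insert.IH by blast
  \<comment> \<open>The induction hypothesis serves a second time, now to project \<open>a\<close>
    itself; \<open>e\<close> is the part of \<open>a\<close> orthogonal to \<open>S\<close>.\<close>
  obtain q where q: "q \<in> span S" "a - q \<in> orth_compl S" using insert.IH by blast
  define e where "e = a - q"
  \<comment> \<open>The Fourier coefficient of \<open>v - p\<close> along \<open>e\<close>; it is 0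
    by the convention on division if \<open>a\<close> already lies in \<open>span S\<close>, where
    \<open>e = 0\<close>.\<close>
  define c where "c = ip (v - p) e / ip e e"
  define r where "r = p + scale c e"
  have "p \<in> span (insert a S)" "q \<in> span (insert a S)" "a \<in> span (insert a S)"
    using p q span_mono[of S "insert a S"] by (auto intro: span_base)
  then have "r \<in> span (insert a S)"
    unfolding r_def e_def by (intro span_add span_scale span_diff)
  moreover have "v - r \<in> orth_compl (insert a S)"
  proof -
    have vr: "v - r = v - p - scale c e" by (simp add: r_def)
    have S: "v - r \<in> orth_compl S"
      unfolding vr using p q subspace_orth_compl
      by (auto simp: e_def intro: subspace_diff subspace_scale)
    have "ip (v - r) e = 0"
    proof (cases "e = 0")
      case True
      then show ?thesis using orth_sym ip_zero_left by blast
    next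
      case False
      then have "ip e e \<noteq> 0" using ip_anisotropic by blast
      then show ?thesis by (simp add: vr ip_diff_left ip_scale_left c_def)
    qed
    moreover have "ip (v - r) q = 0"
      using S q unfolding orth_compl_span[of S, symmetric] by (simp add: orth_compl_def)
    \<comment> \<open>Since \<open>a = e + q\<close>, the arguments are swapped to add in the first
      one, then swapped back.\<close>
    ultimately have "ip (e + q) (v - r) = 0"
      unfolding ip_add_left by (metis add_0_right orth_sym)
    then have "ip (v - r) a = 0"
      unfolding e_def by (metis diff_add_cancel orth_sym)
    then show ?thesis using S by (simp add: orth_compl_def)
  qed
  ultimately show ?case by blast
qed

lemma orthogonal_projection:
  assumes "subspace W"
  obtains p where "p \<in> W" "v - p \<in> orth_compl W"
proof -
  obtain S where S: "S \<subseteq> W" "independent S" "W \<subseteq> span S"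
    by (rule basis_exists)
  then have "span S = W"
    using assms by (metis span_minimal subset_antisym)
  moreover obtain p where "p \<in> span S" "v - p \<in> orth_compl (span S)"
    using orthogonal_projection_span[OF finiteI_independent[OF S(2)]] orth_compl_span by blast
  ultimately show thesis using that by blast
qed

lemma dim_psubspace:
  assumes "subspace U" "subspace W" "U \<subset> W"
  shows "dim U < dim W"
proof (rule ccontr)
  assume "\<not> dim U < dim W"
  then have "U = W"
    using assms by (intro subspace_dim_equal) auto
  then show False using assms by blast
qed

section \<open>Orthogonal families are direct\<close>

text \<open>Spanning gives existence of components. For uniqueness, the differences of two component
  families sum to 0; pairing this sum with one difference leaves its square, which anisotropy forces
  to vanish.\<close>

lemma internal_direct_sum_orthogonal:
  assumes fin: "finite \<W>" and sub: "\<And>W. W \<in> \<W> \<Longrightarrow> subspace W"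
    and orth: "\<And>W W'. W \<in> \<W> \<Longrightarrow> W' \<in> \<W> \<Longrightarrow> W \<noteq> W' \<Longrightarrow> W \<subseteq> orth_compl W'"
    and span: "span (\<Union>\<W>) = UNIV"
  shows "internal_direct_sum \<W>"
proof -
  let ?P = "\<lambda>c. (\<forall>W\<in>\<W>. c W \<in> W) \<and> (\<forall>W. W \<notin> \<W> \<longrightarrow> c W = 0)"
  \<comment> \<open>Sums over varying supports become sums over the fixed finite index set
    \<W>.\<close>
  have supp: "finite {W. c W \<noteq> 0}" "(\<Sum>W | c W \<noteq> 0. c W) = (\<Sum>W\<in>\<W>. c W)"
    if "?P c" for c :: "'v set \<Rightarrow> 'v"
  proof -
    have sub: "{W. c W \<noteq> 0} \<subseteq> \<W>" using that by auto
    then show "finite {W. c W \<noteq> 0}" using fin finite_subset by blast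
    show "(\<Sum>W | c W \<noteq> 0. c W) = (\<Sum>W\<in>\<W>. c W)"
      using sub fin by (intro sum.mono_neutral_left) auto
  qed
  have ex: "\<exists>c. ?P c \<and> v = (\<Sum>W\<in>\<W>. c W)" for v
  proof -
    have "v \<in> span (\<Union>\<W>)" using span by simp
    then show ?thesis
    proof (induction rule: span_induct_alt)
      case base
      have "?P (\<lambda>_. 0)" using sub subspace_0 by auto
      then show ?case by (intro exI[of _ "\<lambda>_. 0"]) simp
    next
      case (step a x y)
      then obtain c W0 where c: "?P c" "y = (\<Sum>W\<in>\<W>. c W)" and W0: "x \<in> W0" "W0 \<in> \<W>"
        by blast
      define d where "d = (\<lambda>W. (if W = W0 then scale a x else 0) + c W)"
      have "?P d"
        using c W0 sub by (auto simp: d_def intro: subspace_add subspace_scale)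
      moreover have "scale a x + y = (\<Sum>W\<in>\<W>. d W)"
        using c W0 fin by (simp add: d_def sum.distrib)
      ultimately show ?case by blast
    qed
  qed
  have uniq: "c W = d W"
    if c: "?P c" and d: "?P d" and eq: "(\<Sum>W\<in>\<W>. c W) = (\<Sum>W\<in>\<W>. d W)"
    for c d :: "'v set \<Rightarrow> 'v" and W
  proof (cases "W \<in> \<W>")
    case True
    let ?e = "\<lambda>W. c W - d W"
    have mem: "?e W' \<in> W'" if "W' \<in> \<W>" for W'
      using that c d sub by (auto intro: subspace_diff)
    \<comment> \<open>The square is padded with zeros so that orthogonality can identify it with the
      full sum term by term.\<close>
    have "ip (?e W) (?e W) = (\<Sum>W'\<in>\<W>. if W' = W then ip (?e W) (?e W) else 0)"
      using True fin by simp
    also have "\<dots> = (\<Sum>W'\<in>\<W>. ip (?e W') (?e W))"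
      using mem orth True by (intro sum.cong) (auto simp: orth_compl_def subset_iff)
    also have "\<dots> = ip (\<Sum>W'\<in>\<W>. ?e W') (?e W)"
      by (simp add: ip_sum_left)
    also have "\<dots> = 0"
      using eq by (simp add: sum_subtractf ip_zero_left)
    finally show ?thesis using ip_anisotropic by fastforce
  next
    case False
    then show ?thesis using c d by simp
  qed
  have "\<exists>!c. (\<forall>W\<in>\<W>. c W \<in> W) \<and> (\<forall>W. W \<notin> \<W> \<longrightarrow> c W = 0) \<and>
          finite {W. c W \<noteq> 0} \<and> v = (\<Sum>W | c W \<noteq> 0. c W)" for v
  proof -
    obtain c where c: "?P c" "v = (\<Sum>W\<in>\<W>. c W)" using ex by blast
    show ?thesis
    proof (rule ex1I[of _ c])
      show "(\<forall>W\<in>\<W>. c W \<in> W) \<and> (\<forall>W. W \<notin> \<W> \<longrightarrow> c W = 0) \<and>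
          finite {W. c W \<noteq> 0} \<and> v = (\<Sum>W | c W \<noteq> 0. c W)"
        using c supp[of c] by simp
    next
      fix d :: "'v set \<Rightarrow> 'v"
      assume d: "(\<forall>W\<in>\<W>. d W \<in> W) \<and> (\<forall>W. W \<notin> \<W> \<longrightarrow> d W = 0) \<and>
          finite {W. d W \<noteq> 0} \<and> v = (\<Sum>W | d W \<noteq> 0. d W)"
      then have "?P d" by blast
      moreover have "v = (\<Sum>W\<in>\<W>. d W)" using d supp(2)[OF \<open>?P d\<close>] by simp
      then have "(\<Sum>W\<in>\<W>. d W) = (\<Sum>W\<in>\<W>. c W)" using c(2) by (rule trans[OF sym])
      ultimately show "d = c" using uniq[OF _ c(1)] by (intro ext)
    qed
  qed
  then show ?thesis
    unfolding internal_direct_sum_def using sub by blast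
qed

end

section \<open>Isometric representations and their decomposition\<close>

locale isometric_quandle_rep = quandle_rep Q tri scale \<rho> + anisotropic_form scale Basis ip
  for Q :: "'q set" and tri :: "'q \<Rightarrow> 'q \<Rightarrow> 'q"
    and scale :: "'k::field \<Rightarrow> 'v::ab_group_add \<Rightarrow> 'v"
    and \<rho> :: "'q \<Rightarrow> 'v \<Rightarrow> 'v" and Basis :: "'v set" and ip :: "'v \<Rightarrow> 'v \<Rightarrow> 'k" +
  assumes isometry: "x \<in> Q \<Longrightarrow> ip (\<rho> x v) (\<rho> x w) = ip v w"
begin

text \<open>Stability gives one inclusion. As \<open>\<rho> x\<close> is injective, the image has
  the dimension of \<open>W\<close>, and finite dimension turns the inclusion into equality.\<close>

lemma subrep_image_eq:
  assumes "subrep W" "x \<in> Q"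
  shows "\<rho> x ` W = W"
proof -
  have lin: "Vector_Spaces.linear scale scale (\<rho> x)" and "bij (\<rho> x)"
    using rep_GL[OF \<open>x \<in> Q\<close>] by (auto simp: GL_def)
  interpret pair: finite_dimensional_vector_space_pair_1 scale Basis scale
    by unfold_locales
  have "dim (\<rho> x ` W) = dim W"
    using lin \<open>bij (\<rho> x)\<close>
    by (intro pair.dim_image_eq) (auto simp: bij_def intro: inj_on_subset)
  moreover have "subspace (\<rho> x ` W)"
    using lin assms(1) by (auto simp: subrep_def intro: pair.linear_subspace_image)
  ultimately show ?thesis
    using assms by (intro subspace_dim_equal) (auto simp: subrep_def)
qed

text \<open>Every vector of \<open>W\<close> has the form \<open>\<rho> x w'\<close> with
  \<open>w'\<close> in \<open>W\<close>, so the isometry reduces its pairing with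
  \<open>\<rho> x v\<close> to the pairing of \<open>v\<close> with \<open>w'\<close>.\<close>

lemma subrep_orth_compl:
  assumes "subrep W"
  shows "subrep (orth_compl W)"
  unfolding subrep_def
proof (intro conjI ballI subspace_orth_compl subsetI)
  fix x u
  assume x: "x \<in> Q" and "u \<in> \<rho> x ` orth_compl W"
  then obtain v where v: "v \<in> orth_compl W" and u: "u = \<rho> x v" by blast
  have "ip u w = 0" if "w \<in> W" for w
  proof -
    have "w \<in> \<rho> x ` W" using that by (simp add: subrep_image_eq[OF assms x])
    then obtain w' where "w' \<in> W" "w = \<rho> x w'" by blast
    then show ?thesis using v x by (simp add: u isometry orth_compl_def)
  qed
  then show "u \<in> orth_compl W" by (simp add: orth_compl_def)
qed

lemma subrep_Int: "subrep U \<Longrightarrow> subrep W \<Longrightarrow> subrep (U \<inter> W)"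
  unfolding subrep_def by (blast intro: subspace_inter)

text \<open>An arbitrary \<open>U\<close> is needed for the induction on \<open>dim U\<close>.
  Orthogonality is recorded instead of directness because it passes easily to the union of two
  families.\<close>

lemma orthogonal_irreducible_decomposition:
  assumes "subrep U"
  shows "\<exists>\<W>. finite \<W> \<and> (\<forall>W\<in>\<W>. irreducible_subrep W) \<and>
    (\<forall>W\<in>\<W>. \<forall>W'\<in>\<W>. W \<noteq> W' \<longrightarrow> W \<subseteq> orth_compl W') \<and> span (\<Union>\<W>) = U"
  using assms
proof (induction "dim U" arbitrary: U rule: less_induct)
  case less
  note U = \<open>subrep U\<close>
  then have subU: "subspace U" by (simp add: subrep_def)
  show ?case
  proof (cases "irreducible_subrep U")
    case True
    \<comment> \<open>This case includes \<open>U = {0}\<close>, which counts as irreducible, so the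
      induction has no separate base case.\<close>
    then show ?thesis
      using subU by (intro exI[of _ "{U}"]) simp
  next
    case False
    then obtain U1 where U1: "subrep U1" "U1 \<subset> U" "U1 \<noteq> {0}"
      using U by (auto simp: irreducible_subrep_def)
    define U2 where "U2 = U \<inter> orth_compl U1"
    have U2: "subrep U2"
      unfolding U2_def using U U1 by (intro subrep_Int subrep_orth_compl)
    have sub: "subspace U1" "subspace U2" using U1 U2 by (auto simp: subrep_def)
    \<comment> \<open>A nonzero vector of \<open>U1\<close> is not orthogonal to itself, so it
      witnesses that \<open>U2\<close> is strictly smaller than \<open>U\<close>.\<close>
    then obtain u where "u \<in> U1" "u \<noteq> 0" using U1 subspace_0 by blast
    then have "u \<in> U" "u \<notin> U2"
      using U1 ip_anisotropic by (auto simp: U2_def orth_compl_def)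
    then have "U2 \<subset> U" by (auto simp: U2_def)
    then have dims: "dim U1 < dim U" "dim U2 < dim U"
      using U1 sub subU by (auto intro: dim_psubspace)
    obtain \<A> where \<A>: "finite \<A>" "\<forall>W\<in>\<A>. irreducible_subrep W"
      "\<forall>W\<in>\<A>. \<forall>W'\<in>\<A>. W \<noteq> W' \<longrightarrow> W \<subseteq> orth_compl W'" "span (\<Union>\<A>) = U1"
      using less.hyps[OF dims(1) U1(1)] by blast
    obtain \<B> where \<B>: "finite \<B>" "\<forall>W\<in>\<B>. irreducible_subrep W"
      "\<forall>W\<in>\<B>. \<forall>W'\<in>\<B>. W \<noteq> W' \<longrightarrow> W \<subseteq> orth_compl W'" "span (\<Union>\<B>) = U2"
      using less.hyps[OF dims(2) U2] by blast
    have in1: "W \<subseteq> U1" if "W \<in> \<A>" for W using that \<A>(4) span_superset by blast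
    have in2: "W \<subseteq> U2" if "W \<in> \<B>" for W using that \<B>(4) span_superset by blast
    have orth: "W' \<subseteq> orth_compl W" if "W \<in> \<A>" "W' \<in> \<B>" for W W'
      using in1[OF that(1)] in2[OF that(2)] by (auto simp: U2_def orth_compl_def)
    then have orth': "W \<subseteq> orth_compl W'" if "W \<in> \<A>" "W' \<in> \<B>" for W W'
      using that subset_orth_compl_iff by blast
    have span: "span (\<Union>(\<A> \<union> \<B>)) = U"
    proof
      show "span (\<Union>(\<A> \<union> \<B>)) \<subseteq> U"
        using in1 in2 U1(2) \<open>U2 \<subset> U\<close> subU by (intro span_minimal) blast+
      show "U \<subseteq> span (\<Union>(\<A> \<union> \<B>))"
      proof
        fix v assume v: "v \<in> U"
        \<comment> \<open>Projecting to \<open>U1\<close> shows that \<open>U\<close> is the sum of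
          \<open>U1\<close> and \<open>U2\<close>: the remainder stays in \<open>U\<close> because
          \<open>p\<close> does.\<close>
        obtain p where p: "p \<in> U1" "v - p \<in> orth_compl U1"
          using orthogonal_projection[OF sub(1)] by blast
        then have "v - p \<in> U2"
          using v U1 subU by (auto simp: U2_def intro: subspace_diff)
        then have "p \<in> span (\<Union>(\<A> \<union> \<B>))" "v - p \<in> span (\<Union>(\<A> \<union> \<B>))"
          using p(1) \<A>(4) \<B>(4) span_mono[of "\<Union>\<A>" "\<Union>(\<A> \<union> \<B>)"] span_mono[of "\<Union>\<B>" "\<Union>(\<A> \<union> \<B>)"]
          by auto
        then have "p + (v - p) \<in> span (\<Union>(\<A> \<union> \<B>))" by (rule span_add)
        then show "v \<in> span (\<Union>(\<A> \<union> \<B>))" by simp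
      qed
    qed
    have "finite (\<A> \<union> \<B>)" "\<forall>W\<in>\<A> \<union> \<B>. irreducible_subrep W"
      using \<A>(1,2) \<B>(1,2) by auto
    moreover have "\<forall>W\<in>\<A> \<union> \<B>. \<forall>W'\<in>\<A> \<union> \<B>. W \<noteq> W' \<longrightarrow> W \<subseteq> orth_compl W'"
      by (metis \<A>(3) \<B>(3) orth orth' UnE)
    ultimately show ?thesis
      using span by (intro exI[of _ "\<A> \<union> \<B>"] conjI)
  qed
qed

lemma completely_reducible: completely_reducible
proof -
  have UNIV: "subrep UNIV" by (simp add: subrep_def)
  obtain \<W> where \<W>: "finite \<W>" "\<forall>W\<in>\<W>. irreducible_subrep W"
    "\<forall>W\<in>\<W>. \<forall>W'\<in>\<W>. W \<noteq> W' \<longrightarrow> W \<subseteq> orth_compl W'" "span (\<Union>\<W>) = UNIV"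
    using orthogonal_irreducible_decomposition[OF UNIV] by blast
  then have "internal_direct_sum \<W>"
    by (intro internal_direct_sum_orthogonal) (auto simp: irreducible_subrep_def subrep_def)
  then show ?thesis using \<W>(2) by (auto simp: completely_reducible_def)
qed

end

section \<open>Specialization to real and complex inner products\<close>

theorem theorem2p2:
  fixes Q :: "'q set" and tri :: "'q \<Rightarrow> 'q \<Rightarrow> 'q"
    and \<rho> :: "'q \<Rightarrow> 'v::ab_group_add \<Rightarrow> 'v" and B :: "'v set"
    and rscale :: "real \<Rightarrow> 'v \<Rightarrow> 'v" and rip :: "'v \<Rightarrow> 'v \<Rightarrow> real"
    and cscale :: "complex \<Rightarrow> 'v \<Rightarrow> 'v" and cip :: "'v \<Rightarrow> 'v \<Rightarrow> complex"
  shows "(finite_dimensional_vector_space rscale B \<and>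
            real_unitary_quandle_rep Q tri rscale \<rho> rip \<longrightarrow>
          quandle_rep.completely_reducible Q rscale \<rho>) \<and>
         (finite_dimensional_vector_space cscale B \<and>
            complex_unitary_quandle_rep Q tri cscale \<rho> cip \<longrightarrow>
          quandle_rep.completely_reducible Q cscale \<rho>)"
proof (intro conjI impI; elim conjE)
  assume fd: "finite_dimensional_vector_space rscale B"
    and rep: "real_unitary_quandle_rep Q tri rscale \<rho> rip"
  interpret finite_dimensional_vector_space rscale B by (fact fd)
  interpret R: real_unitary_quandle_rep Q tri rscale \<rho> rip by (fact rep)
  interpret I: isometric_quandle_rep Q tri rscale \<rho> B rip
  proof unfold_locales
    show "rip w v = 0" if "rip v w = 0" for v w using that R.ip_sym by metis
    show "v = 0" if "rip v v = 0" for v using that R.ip_pos[of v] by auto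
  qed (simp_all add: R.ip_add_left R.ip_scale_left R.isometry)
  show "quandle_rep.completely_reducible Q rscale \<rho>" by (fact I.completely_reducible)
next
  assume fd: "finite_dimensional_vector_space cscale B"
    and rep: "complex_unitary_quandle_rep Q tri cscale \<rho> cip"
  interpret finite_dimensional_vector_space cscale B by (fact fd)
  interpret C: complex_unitary_quandle_rep Q tri cscale \<rho> cip by (fact rep)
  interpret I: isometric_quandle_rep Q tri cscale \<rho> B cip
  proof unfold_locales
    \<comment> \<open>Hermitian symmetry suffices because conjugation fixes 0.\<close>
    show "cip w v = 0" if "cip v w = 0" for v w using that C.ip_sym[of w v] by simp
    show "v = 0" if "cip v v = 0" for v using that C.ip_pos[of v] by auto
  qed (simp_all add: C.ip_add_left C.ip_scale_left C.isometry)
  show "quandle_rep.completely_reducible Q cscale \<rho>" by (fact I.completely_reducible)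
qed

end
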